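(* Let $s\in(0,1)$. For a tetrahedron $t$ and a panel $\tau$ of the mesh such that $\tau$ is a face of $t$, or $t$ and $\tau$ have exactly a common edge, or exactly a common vertex, the respective regularized integrands $\tilde k_{2,F}:[0,1]^2\to\mathbb R$, $\tilde k_{2,E}:[0,1]^3\to\mathbb R$ and $\tilde k_{2,V}:[0,1]^4\to\mathbb R$ are componentwise analytic.
   Context: **Componentwise analytic.** For $\rho>1/2$ let $\mathcal E_\rho\subset\mathbb C$ be the closed ellipse with foci $0$ and $1$ whose semi-axes have sum $\rho$. A function $f:[0,1]^k\to\mathbb C$ is componentwise analytic if for each $i=1,\dots,k$ there is $\rho_i>1/2$ such that for every $x\in[0,1]^k$ the function $t\mapsto f(x_1,\dots,x_{i-1},t,x_{i+1},\dots,x_k)$ on $[0,1]$ extends to an analytic function on $\mathcal E_{\rho_i}$. **Meshes.** $\Omega\subset\mathbb R^3$ is a bounded polyhedral Lipschitz domain with a conforming partition $\mathcal T$ into closed nondegenerate tetrahedra; $\mathcal P$ is the set of all faces (panels) of the tetrahedra. The minimal interior angle of each tetrahedron (smallest among planar angles of its faces and its dihedral angles) is larger than $\theta_{\mathcal T}>0$, and there are $c_1,c_2>0$ with $c_1h_{t_1}\le h_{t_2}\le c_2h_{t_1}$ for all $t_1,t_2\in\mathcal T$, $h_t$ being the diameter of $t$. There is $c_A>0$ such that whenever $t\in\mathcal T$, $\tau\in\mathcal P$ intersect exactly in a common vertex, edge or face $S$, for all $x\in t$, $y\in\tau$ there is $p\in S$ with $|x-y|\ge c_A(|x-p|+|p-y|)$.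 $\varphi_1,\dots,\varphi_N$ is the nodal basis (one function per inner node) of the continuous piecewise linear functions on $\mathcal T$ vanishing on $\partial\Omega$. **Reference maps.** For a tetrahedron $t$ with vertices $a_t,b_t,c_t,d_t$: $\chi_t(\tilde x)=M_t\tilde x+a_t$, $M_t=[b_t-a_t,c_t-b_t,d_t-b_t]$, mapping $\{\tilde x\in\mathbb R^3:0\le\tilde x_1\le1,\ 0\le\tilde x_2\le\tilde x_1,\ 0\le\tilde x_3\le\tilde x_1-\tilde x_2\}$ onto $t$. For a panel $\tau$ with vertices $a_\tau,b_\tau,c_\tau$: $\chi_\tau(\tilde y)=M_\tau\tilde y+a_\tau$, $M_\tau=[b_\tau-a_\tau,c_\tau-b_\tau]$, mapping $\{\tilde y\in\mathbb R^2:0\le\tilde y_2\le\tilde y_1\le1\}$ onto $\tau$. The vertices are ordered so that common ones come first, in the same order (V: $a_t=a_\tau$; E: also $b_t=b_\tau$; F: also $c_t=c_\tau$). $\lambda_i^t$ is the affine function on $\mathbb R^3$ coinciding with $\varphi_i$ on $t$; $n_\tau$ is the constant unit normal of $\tau$. For given indices $i,j$, $$\tilde k_2(\tilde x,\tilde y)=\lambda_i^t(\chi_t(\tilde x))\lambda_j^t(\chi_t(\tilde x))\frac{(\chi_\tau(\tilde y)-\chi_t(\tilde x))^Tn_\tau}{|\chi_\tau(\tilde y)-\chi_t(\tilde x)|^{3+2s}}|\det M_t|\,|(b_\tau-a_\tau)\times(c_\tau-b_\tau)|$$ for all $\tilde x\in\mathbb R^3,\tilde y\in\mathbb R^2$ with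 nonzero denominator. **Regularized integrands.** $\tilde k_{2,\star}(\eta)=\sum_m\tilde k_2(\mathscr D_m(\eta))J_m(\eta)$ with: (V, common vertex) $\mathscr D_1=((1,\eta_1\eta_2,\eta_1(1-\eta_2)),(\eta_3,\eta_3\eta_4))$, $\mathscr D_2=((\eta_2,\eta_2\eta_3\eta_4,\eta_2\eta_3(1-\eta_4)),(1,\eta_1))$; $J_1=\eta_1\eta_3$, $J_2=\eta_2^2\eta_3$. (E, common edge) $\mathscr D_1=((0,\eta_1,1-\eta_1),(-\eta_2\eta_3,\eta_2(1-\eta_3)))$, $\mathscr D_2=((0,\eta_2\eta_3,\eta_2(1-\eta_3)),(-\eta_1,1-\eta_1))$, $\mathscr D_3=((-\eta_2\eta_3,\eta_2(1-\eta_3),1-\eta_2),(0,\eta_1))$, $\mathscr D_4=((-\eta_1\eta_2\eta_3,\eta_1\eta_2(1-\eta_3),\eta_1(1-\eta_2)),(0,1))$; $J_1=J_2=J_3=\eta_2$, $J_4=\eta_1^2\eta_2$. (F, $\tau$ a face of $t$) $\mathscr D_1=((0,\eta_1,1-\eta_1),(-\eta_1\eta_2,0))$, $\mathscr D_2=((0,\eta_1\eta_2,\eta_1(1-\eta_2)),(-1,0))$, $\mathscr D_3=((0,\eta_1\eta_2,1-\eta_1\eta_2),(-\eta_1,0))$, $\mathscr D_4=((0,0,1),(-\eta_1\eta_2,\eta_1(1-\eta_2)))$, $\mathscr D_5=((-\eta_1\eta_2,\eta_1(1-\eta_2),1-\eta_1),(0,0))$, $\mathscr D_6=((-\eta_1,0,1-\eta_1),(0,\eta_1\eta_2))$,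 $\mathscr D_7=((-\eta_1\eta_2,0,\eta_1(1-\eta_2)),(0,1))$, $\mathscr D_8=((-\eta_1\eta_2,0,1-\eta_1\eta_2),(0,\eta_1))$, $\mathscr D_9=((0,0,\eta_2),(-\eta_1,1-\eta_1))$; $J_m=\eta_1$ for $m\le8$, $J_9=1$. *)

theory Defs
  imports "HOL-Analysis.Analysis"
begin

section \<open>Componentwise analytic functions\<close>

text \<open>
  If an ellipse with foci \<open>0\<close>, \<open>1\<close> has semi-axes \<open>p \<ge> q\<close> with \<open>p + q = \<rho>\<close>, then
  \<open>p\<^sup>2 - q\<^sup>2 = 1/4\<close>, so its major axis is \<open>2 p = \<rho> + 1 / (4 \<rho>)\<close>; this is the bound on the sum
  of the distances to the foci.
\<close>
definition ellipse :: "real \<Rightarrow> complex set" where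
  "ellipse \<rho> = {z. dist z 0 + dist z 1 \<le> \<rho> + 1 / (4 * \<rho>)}"

lemma ellipse_major_axis:
  fixes p q \<rho> :: real
  assumes "p + q = \<rho>" "p\<^sup>2 - q\<^sup>2 = (1/2)\<^sup>2" "\<rho> > 0"
  shows "2 * p = \<rho> + 1 / (4 * \<rho>)"
proof -
  have "(p - q) * (p + q) = 1 / 4"
    using assms(2) by (simp add: power2_eq_square algebra_simps)
  then have "p - q = 1 / (4 * \<rho>)"
    using assms(1,3) by (simp add: field_simps)
  then show ?thesis using assms(1) by linarith
qed

definition unit_cube :: "(real ^ 'k) set" where
  "unit_cube = {x. \<forall>i. 0 \<le> x $ i \<and> x $ i \<le> 1}"

definition componentwise_analytic :: "(real ^ 'k \<Rightarrow> complex) \<Rightarrow> bool" where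
  "componentwise_analytic f \<longleftrightarrow>
     (\<forall>i. \<exists>\<rho>>1/2. \<forall>x\<in>unit_cube. \<exists>g. g analytic_on ellipse \<rho> \<and>
        (\<forall>t\<in>{0..1}. g (of_real t) = f (\<chi> j. if j = i then t else x $ j)))"


section \<open>Domain and mesh\<close>

definition lipschitz_boundary :: "(real ^ 3) set \<Rightarrow> bool" where
  "lipschitz_boundary \<Omega> \<longleftrightarrow>
     (\<forall>p\<in>frontier \<Omega>. \<exists>e r L g. norm e = 1 \<and> r > 0 \<and> L-lipschitz_on UNIV g \<and>
        (\<forall>x\<in>ball p r. x \<in> \<Omega> \<longleftrightarrow> x \<bullet> e < g (x - (x \<bullet> e) *\<^sub>R e)))"

definition polyhedral_lipschitz_domain :: "(real ^ 3) set \<Rightarrow> bool" where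
  "polyhedral_lipschitz_domain \<Omega> \<longleftrightarrow>
     open \<Omega> \<and> connected \<Omega> \<and> \<Omega> \<noteq> {} \<and> bounded \<Omega> \<and> lipschitz_boundary \<Omega> \<and>
     (\<exists>F. finite F \<and> (\<forall>P\<in>F. polytope P) \<and> closure \<Omega> = \<Union>F)"

definition vertices :: "(real ^ 3) set \<Rightarrow> (real ^ 3) set" where
  "vertices S = {v. v extreme_point_of S}"

definition panels :: "(real ^ 3) set set \<Rightarrow> (real ^ 3) set set" where
  "panels \<T> = {\<tau>. \<exists>t\<in>\<T>. \<tau> facet_of t}"

definition vec_angle :: "real ^ 3 \<Rightarrow> real ^ 3 \<Rightarrow> real" where
  "vec_angle u v = arccos ((u \<bullet> v) / (norm u * norm v))"

definition planar_angle :: "real ^ 3 \<Rightarrow> real ^ 3 \<Rightarrow> real ^ 3 \<Rightarrow> real" where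
  "planar_angle p q r = vec_angle (q - p) (r - p)"

definition orth_part :: "real ^ 3 \<Rightarrow> real ^ 3 \<Rightarrow> real ^ 3" where
  "orth_part e u = u - ((u \<bullet> e) / (e \<bullet> e)) *\<^sub>R e"

text \<open>The dihedral angle at the edge \<open>p q\<close> between the faces \<open>p q r\<close> and \<open>p q s\<close>.\<close>
definition dihedral_angle :: "real ^ 3 \<Rightarrow> real ^ 3 \<Rightarrow> real ^ 3 \<Rightarrow> real ^ 3 \<Rightarrow> real" where
  "dihedral_angle p q r s =
     vec_angle (orth_part (q - p) (r - p)) (orth_part (q - p) (s - p))"

definition interior_angles :: "(real ^ 3) set \<Rightarrow> real set" where
  "interior_angles t =
     {planar_angle p q r | p q r. distinct [p, q, r] \<and> {p, q, r} \<subseteq> vertices t} \<union>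
     {dihedral_angle p q r s | p q r s. distinct [p, q, r, s] \<and> {p, q, r, s} \<subseteq> vertices t}"

text \<open>
  \<^const>\<open>triangulation\<close> provides finiteness and conformity: any two elements intersect in a
  (possibly empty) common face.
\<close>
locale mesh =
  fixes \<Omega> :: "(real ^ 3) set" and \<T> :: "(real ^ 3) set set"
    and \<theta> c\<^sub>1 c\<^sub>2 c\<^sub>A :: real
  assumes domain: "polyhedral_lipschitz_domain \<Omega>"
    and conforming: "triangulation \<T>"
    and tetrahedra: "\<And>t. t \<in> \<T> \<Longrightarrow> 3 simplex t"
    and partition: "\<Union>\<T> = closure \<Omega>"
    and theta_pos: "\<theta> > 0"
    and min_angle: "\<And>t. t \<in> \<T> \<Longrightarrow> \<theta> < Min (interior_angles t)"
    and c_pos: "c\<^sub>1 > 0" "c\<^sub>2 > 0"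
    and quasi_uniform: "\<And>t1 t2. \<lbrakk>t1 \<in> \<T>; t2 \<in> \<T>\<rbrakk> \<Longrightarrow>
          c\<^sub>1 * diameter t1 \<le> diameter t2 \<and> diameter t2 \<le> c\<^sub>2 * diameter t1"
    and cA_pos: "c\<^sub>A > 0"
    and separation: "\<And>t \<tau> S x y.
          \<lbrakk>t \<in> \<T>; \<tau> \<in> panels \<T>; S = t \<inter> \<tau>; S \<noteq> {}; S face_of t; S face_of \<tau>; x \<in> t; y \<in> \<tau>\<rbrakk> \<Longrightarrow>
          \<exists>p\<in>S. dist x y \<ge> c\<^sub>A * (dist x p + dist p y)"


section \<open>Nodal basis\<close>

definition affine_function :: "(real ^ 3 \<Rightarrow> real) \<Rightarrow> bool" where
  "affine_function l \<longleftrightarrow> (\<exists>v c. l = (\<lambda>x. v \<bullet> x + c))"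

definition p1_space :: "(real ^ 3) set \<Rightarrow> (real ^ 3) set set \<Rightarrow> (real ^ 3 \<Rightarrow> real) set" where
  "p1_space \<Omega> \<T> = {u. continuous_on (closure \<Omega>) u \<and>
      (\<forall>t\<in>\<T>. \<exists>l. affine_function l \<and> (\<forall>x\<in>t. u x = l x)) \<and> (\<forall>x\<in>frontier \<Omega>. u x = 0)}"

definition inner_nodes :: "(real ^ 3) set \<Rightarrow> (real ^ 3) set set \<Rightarrow> (real ^ 3) set" where
  "inner_nodes \<Omega> \<T> = (\<Union>t\<in>\<T>. vertices t) \<inter> \<Omega>"

definition nodal_basis ::
    "(real ^ 3) set \<Rightarrow> (real ^ 3) set set \<Rightarrow> nat \<Rightarrow> (nat \<Rightarrow> real ^ 3 \<Rightarrow> real) \<Rightarrow> bool" where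
  "nodal_basis \<Omega> \<T> N \<phi> \<longleftrightarrow>
     (\<exists>z. bij_betw z {1..N} (inner_nodes \<Omega> \<T>) \<and>
        (\<forall>i\<in>{1..N}. \<phi> i \<in> p1_space \<Omega> \<T> \<and>
           (\<forall>j\<in>{1..N}. \<phi> i (z j) = (if i = j then 1 else 0))))"

text \<open>The affine function on the whole space that coincides with \<open>u\<close> on \<open>t\<close>.\<close>
definition affine_ext :: "(real ^ 3) set \<Rightarrow> (real ^ 3 \<Rightarrow> real) \<Rightarrow> real ^ 3 \<Rightarrow> real" where
  "affine_ext t u = (THE l. affine_function l \<and> (\<forall>x\<in>t. l x = u x))"


section \<open>Reference maps and the transformed kernel\<close>

definition vertex_list :: "(real ^ 3) set \<Rightarrow> (real ^ 3) list \<Rightarrow> bool" where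
  "vertex_list S vs \<longleftrightarrow> distinct vs \<and> set vs = vertices S"

definition unit_normal :: "(real ^ 3) set \<Rightarrow> real ^ 3 \<Rightarrow> bool" where
  "unit_normal \<tau> n \<longleftrightarrow> norm n = 1 \<and> (\<forall>x\<in>\<tau>. \<forall>y\<in>\<tau>. n \<bullet> (x - y) = 0)"

text \<open>\<^const>\<open>vector\<close> lists rows; the vertex differences are the columns, hence the transposition.\<close>
definition tet_matrix :: "real ^ 3 \<Rightarrow> real ^ 3 \<Rightarrow> real ^ 3 \<Rightarrow> real ^ 3 \<Rightarrow> real ^ 3 ^ 3" where
  "tet_matrix a b c d = transpose (vector [b - a, c - b, d - b])"

definition panel_matrix :: "real ^ 3 \<Rightarrow> real ^ 3 \<Rightarrow> real ^ 3 \<Rightarrow> real ^ 2 ^ 3" where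
  "panel_matrix a b c = transpose (vector [b - a, c - b])"

definition tet_map ::
    "real ^ 3 \<Rightarrow> real ^ 3 \<Rightarrow> real ^ 3 \<Rightarrow> real ^ 3 \<Rightarrow> real ^ 3 \<Rightarrow> real ^ 3" where
  "tet_map a b c d x = tet_matrix a b c d *v x + a"

definition panel_map :: "real ^ 3 \<Rightarrow> real ^ 3 \<Rightarrow> real ^ 3 \<Rightarrow> real ^ 2 \<Rightarrow> real ^ 3" where
  "panel_map a b c y = panel_matrix a b c *v y + a"

text \<open>
  The tetrahedron has vertices \<open>a, b, c, d\<close>, the panel has vertices \<open>a', b', c'\<close> and unit
  normal \<open>n\<close>; \<open>l1\<close>, \<open>l2\<close> are the two affine functions.
\<close>
definition k2 :: "real \<Rightarrow> (real ^ 3 \<Rightarrow> real) \<Rightarrow> (real ^ 3 \<Rightarrow> real) \<Rightarrow>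
    real ^ 3 \<Rightarrow> real ^ 3 \<Rightarrow> real ^ 3 \<Rightarrow> real ^ 3 \<Rightarrow>
    real ^ 3 \<Rightarrow> real ^ 3 \<Rightarrow> real ^ 3 \<Rightarrow> real ^ 3 \<Rightarrow> real ^ 3 \<Rightarrow> real ^ 2 \<Rightarrow> real" where
  "k2 s l1 l2 a b c d a' b' c' n x y =
     l1 (tet_map a b c d x) * l2 (tet_map a b c d x) *
     (((panel_map a' b' c' y - tet_map a b c d x) \<bullet> n) /
      norm (panel_map a' b' c' y - tet_map a b c d x) powr (3 + 2 * s)) *
     \<bar>det (tet_matrix a b c d)\<bar> * norm (cross3 (b' - a') (c' - b'))"


section \<open>Regularized integrands\<close>

text \<open>Each entry \<open>(x, y, J)\<close> is a point \<open>\<D>\<^sub>m(\<eta>) = (x, y)\<close> together with the weight \<open>J\<^sub>m(\<eta>)\<close>.\<close>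
type_synonym 'k rule = "real ^ 'k \<Rightarrow> ((real ^ 3) \<times> (real ^ 2) \<times> real) list"

definition rule_V :: "4 rule" where
  "rule_V \<eta> = (let e1 = \<eta> $ 1; e2 = \<eta> $ 2; e3 = \<eta> $ 3; e4 = \<eta> $ 4 in
    [(vector [1, e1 * e2, e1 * (1 - e2)], vector [e3, e3 * e4], e1 * e3),
     (vector [e2, e2 * e3 * e4, e2 * e3 * (1 - e4)], vector [1, e1], e2\<^sup>2 * e3)])"

definition rule_E :: "3 rule" where
  "rule_E \<eta> = (let e1 = \<eta> $ 1; e2 = \<eta> $ 2; e3 = \<eta> $ 3 in
    [(vector [0, e1, 1 - e1], vector [- e2 * e3, e2 * (1 - e3)], e2),
     (vector [0, e2 * e3, e2 * (1 - e3)], vector [- e1, 1 - e1], e2),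
     (vector [- e2 * e3, e2 * (1 - e3), 1 - e2], vector [0, e1], e2),
     (vector [- e1 * e2 * e3, e1 * e2 * (1 - e3), e1 * (1 - e2)], vector [0, 1], e1\<^sup>2 * e2)])"

definition rule_F :: "2 rule" where
  "rule_F \<eta> = (let e1 = \<eta> $ 1; e2 = \<eta> $ 2 in
    [(vector [0, e1, 1 - e1], vector [- e1 * e2, 0], e1),
     (vector [0, e1 * e2, e1 * (1 - e2)], vector [- 1, 0], e1),
     (vector [0, e1 * e2, 1 - e1 * e2], vector [- e1, 0], e1),
     (vector [0, 0, 1], vector [- e1 * e2, e1 * (1 - e2)], e1),
     (vector [- e1 * e2, e1 * (1 - e2), 1 - e1], vector [0, 0], e1),
     (vector [- e1, 0, 1 - e1], vector [0, e1 * e2], e1),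
     (vector [- e1 * e2, 0, e1 * (1 - e2)], vector [0, 1], e1),
     (vector [- e1 * e2, 0, 1 - e1 * e2], vector [0, e1], e1),
     (vector [0, 0, e2], vector [- e1, 1 - e1], 1)])"

definition regularized :: "'k rule \<Rightarrow> (real ^ 3 \<Rightarrow> real ^ 2 \<Rightarrow> real) \<Rightarrow> real ^ 'k \<Rightarrow> real" where
  "regularized R k \<eta> = (\<Sum>(x, y, J)\<leftarrow>R \<eta>. k x y * J)"

text \<open>
  The kernel is a function only where \<open>\<chi>\<^sub>\<tau>(y) \<noteq> \<chi>\<^sub>t(x)\<close>. Since division by zero is total here,
  the well-definedness of the regularized integrand on the cube is recorded separately.
\<close>
definition well_defined_on_cube ::
    "'k::finite rule \<Rightarrow> (real ^ 3 \<Rightarrow> real ^ 3) \<Rightarrow> (real ^ 2 \<Rightarrow> real ^ 3) \<Rightarrow> bool" where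
  "well_defined_on_cube R ft f\<tau> \<longleftrightarrow>
     (\<forall>\<eta>\<in>unit_cube. \<forall>(x, y, J)\<in>set (R \<eta>). f\<tau> y \<noteq> ft x)"

end

theory Submission
  imports Defs
begin

text \<open>
  On the cube each regularized integrand is a sum of products of polynomials with negative powers of
  \<open>|w(\<eta>)|\<^sup>2\<close>, where \<open>w(\<eta>) = \<chi>\<^sub>\<tau>(y(\<eta>)) - \<chi>\<^sub>t(x(\<eta>))\<close> is polynomial. The substitutions
  have factored out the singularity, so \<open>w\<close> has no zero on the cube: if \<open>w(\<eta>) = 0\<close>, then shrinking and
  shifting \<open>x(\<eta>)\<close> and \<open>y(\<eta>)\<close> along the common vertex, edge or face gives a common point of \<open>t\<close> and
  \<open>\<tau>\<close>, whose coordinates are unique and contradict those of \<open>x(\<eta>)\<close> and \<open>y(\<eta>)\<close>.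
  Hence \<open>|w|\<^sup>2\<close>, complexified in one variable, keeps positive real part near \<open>[0,1]\<close>,
  uniformly in the others by compactness, and its powers are analytic there.
\<close>

section \<open>Ellipses shrinking to the unit interval\<close>

text \<open>The increment of the major axis r + 1/(4r) has the factor
  \<open>\<rho> * \<rho>' - 1/4\<close>, which is nonnegative once both parameters are at least
  1/2.\<close>

lemma ellipse_mono:
  assumes "1/2 < \<rho>" "\<rho> \<le> \<rho>'"
  shows "ellipse \<rho> \<subseteq> ellipse \<rho>'"
proof -
  have "1/4 \<le> \<rho> * \<rho>'"
    using mult_mono[of "1/2" \<rho> "1/2" \<rho>'] assms by simp
  then have "0 \<le> (\<rho>' - \<rho>) * (\<rho> * \<rho>' - 1/4) / (\<rho> * \<rho>')"
    using assms by (intro divide_nonneg_pos mult_nonneg_nonneg mult_pos_pos) auto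
  also have "\<dots> = (\<rho>' + 1 / (4 * \<rho>')) - (\<rho> + 1 / (4 * \<rho>))"
    using assms by (simp add: field_simps)
  finally show ?thesis by (auto simp: ellipse_def)
qed

lemma compact_ellipse: "compact (ellipse \<rho>)"
proof -
  have "ellipse \<rho> \<subseteq> cball 0 (\<rho> + 1 / (4 * \<rho>))"
    unfolding ellipse_def by (auto simp: dist_commute intro: order_trans[OF add_increasing2[OF zero_le_dist order_refl]])
  moreover have "closed (ellipse \<rho>)"
    unfolding ellipse_def by (intro closed_Collect_le continuous_intros)
  ultimately show ?thesis
    by (meson bounded_cball bounded_subset compact_eq_bounded_closed)
qed

text \<open>The sum of the distances to the foci attains a minimum \<open>d\<close> on
  \<open>K\<close>. Since \<open>K\<close> misses the segment, \<open>d > 1\<close>, and any ellipse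
  with major axis below \<open>d\<close> avoids \<open>K\<close>.\<close>

lemma ellipse_subset_complement:
  fixes K :: "complex set"
  assumes "compact K" "\<And>t. t \<in> {0..1} \<Longrightarrow> of_real t \<notin> K" "\<rho> > 1/2"
  obtains \<rho>' where "1/2 < \<rho>'" "\<rho>' \<le> \<rho>" "ellipse \<rho>' \<inter> K = {}"
proof (cases "K = {}")
  case True
  with assms(3) that show ?thesis by blast
next
  case False
  have "continuous_on K (\<lambda>z. dist z 0 + dist z 1)" by (intro continuous_intros)
  from continuous_attains_inf[OF assms(1) False this] obtain w where
    w: "w \<in> K" "\<And>z. z \<in> K \<Longrightarrow> dist w 0 + dist w 1 \<le> dist z 0 + dist z 1" by auto
  define d where "d = dist w 0 + dist w 1"
  have "d \<noteq> 1"
  proof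
    assume "d = 1"
    \<comment> \<open>Equality in the triangle inequality puts \<open>w\<close> on the segment
      between the foci.\<close>
    then have "dist (0::complex) 1 = dist 0 w + dist w 1" by (simp add: d_def dist_commute)
    then have "w \<in> closed_segment 0 1"
      unfolding between_mem_segment[symmetric] between .
    then obtain u where "0 \<le> u" "u \<le> 1" "w = of_real u"
      by (auto simp: closed_segment_def scaleR_conv_of_real)
    with assms(2)[of u] w(1) show False by simp
  qed
  moreover have "1 \<le> d"
    using dist_triangle[of 0 1 w] by (simp add: d_def dist_commute)
  ultimately have "1 < d" by simp
  \<comment> \<open>At 1/2 the major axis degenerates to the focal distance 1, so parameters
    slightly above 1/2 give a major axis below \<open>d\<close>.\<close>
  have "((\<lambda>r. r + 1 / (4 * r)) \<longlongrightarrow> 1/2 + 1 / (4 * (1/2))) (at_right (1/2::real))"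
    by (intro tendsto_intros) auto
  then have "((\<lambda>r. r + 1 / (4 * r)) \<longlongrightarrow> 1) (at_right (1/2::real))" by simp
  from order_tendstoD(2)[OF this \<open>1 < d\<close>]
  have "\<forall>\<^sub>F r in at_right (1/2::real). r + 1 / (4 * r) < d \<and> r \<in> {1/2<..<\<rho>}"
    using eventually_at_right_real[OF assms(3)] by (rule eventually_conj)
  then obtain r where r: "r + 1 / (4 * r) < d" "1/2 < r" "r < \<rho>"
    using eventually_happens by (metis (no_types, lifting) greaterThanLessThan_iff trivial_limit_at_right_real)
  have "ellipse r \<inter> K = {}"
    using w(2) r(1) by (force simp: ellipse_def d_def)
  with r that show ?thesis by (meson less_imp_le)
qed

section \<open>Functions with jointly continuous complexifications\<close>

lemma unit_cube_eq_cbox: "unit_cube = cbox 0 (1 :: real ^ 'k)"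
  by (auto simp: unit_cube_def mem_box_cart)

lemma unit_cube_update:
  assumes "x \<in> unit_cube" "t \<in> {0..1}"
  shows "(\<chi> j. if j = i then t else x $ j) \<in> unit_cube"
  using assms by (auto simp: unit_cube_def)

text \<open>
  Joint continuity in the complexified variable and the remaining ones is what makes the
  ellipse uniform in \<open>x\<close>: by compactness of the cube a single ellipse serves all powers of
  a positive function.
\<close>
definition jointly_analytic :: "(real ^ 'k \<Rightarrow> real) \<Rightarrow> bool" where
  "jointly_analytic f \<longleftrightarrow>
     (\<forall>i. \<exists>\<rho>>1/2. \<exists>F. continuous_on (ellipse \<rho> \<times> unit_cube) (\<lambda>(z, x). F z x) \<and>
        (\<forall>x\<in>unit_cube. (\<lambda>z. F z x) analytic_on ellipse \<rho> \<and>
          (\<forall>t\<in>{0..1}. F (of_real t) x = of_real (f (\<chi> j. if j = i then t else x $ j)))))"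

lemma jointly_analytic_imp_componentwise_analytic:
  "jointly_analytic f \<Longrightarrow> componentwise_analytic (\<lambda>x. complex_of_real (f x))"
  unfolding jointly_analytic_def componentwise_analytic_def by meson

text \<open>Replacing one coordinate by a value in [0,1] does not leave the cube, so only values on
  the cube matter. This lets the kernel be rewritten where its denominator is nonzero.\<close>

lemma jointly_analytic_cong:
  assumes "jointly_analytic f" "\<And>x. x \<in> unit_cube \<Longrightarrow> f x = g x"
  shows "jointly_analytic g"
  unfolding jointly_analytic_def
proof
  fix i
  obtain \<rho> F where "\<rho> > 1/2" "continuous_on (ellipse \<rho> \<times> unit_cube) (\<lambda>(z, x). F z x)"
    "\<And>x. x \<in> unit_cube \<Longrightarrow> (\<lambda>z. F z x) analytic_on ellipse \<rho> \<and>
       (\<forall>t\<in>{0..1}. F (of_real t) x = of_real (f (\<chi> j. if j = i then t else x $ j)))"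
    using assms(1) unfolding jointly_analytic_def by meson
  then show "\<exists>\<rho>>1/2. \<exists>F. continuous_on (ellipse \<rho> \<times> unit_cube) (\<lambda>(z, x). F z x) \<and>
        (\<forall>x\<in>unit_cube. (\<lambda>z. F z x) analytic_on ellipse \<rho> \<and>
          (\<forall>t\<in>{0..1}. F (of_real t) x = of_real (g (\<chi> j. if j = i then t else x $ j))))"
    using assms(2)[OF unit_cube_update] by (intro exI[of _ \<rho>] conjI exI[of _ F]) auto
qed

lemma jointly_analytic_const: "jointly_analytic (\<lambda>x. c)"
  unfolding jointly_analytic_def
  by (intro allI exI[of _ 1] conjI exI[of _ "\<lambda>z x. of_real c"] ballI)
     (auto simp: case_prod_unfold)

lemma jointly_analytic_coordinate: "jointly_analytic (\<lambda>x. x $ m)"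
  unfolding jointly_analytic_def
proof
  fix i
  have "continuous_on (ellipse 1 \<times> unit_cube)
      (\<lambda>(z, x). if m = i then z else of_real (x $ m))"
    by (cases "m = i") (auto simp: case_prod_unfold intro!: continuous_intros)
  moreover have "(\<lambda>z. if m = i then z else of_real (x $ m)) analytic_on ellipse 1"
    for x :: "real ^ 'a"
    by (cases "m = i") (auto intro!: analytic_intros)
  ultimately show "\<exists>\<rho>>1/2. \<exists>F. continuous_on (ellipse \<rho> \<times> unit_cube) (\<lambda>(z, x). F z x) \<and>
        (\<forall>x\<in>unit_cube. (\<lambda>z. F z x) analytic_on ellipse \<rho> \<and>
          (\<forall>t\<in>{0..1}. F (of_real t) x =
             complex_of_real ((\<chi> j. if j = i then t else x $ j) $ m)))"
    by (intro exI[of _ 1] conjI exI[of _ "\<lambda>z x. if m = i then z else of_real (x $ m)"]) auto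
qed

text \<open>Common core of sum, product and difference: \<open>G\<close> is the complex form of
  \<open>H\<close>, and the smaller of the two ellipses serves both arguments.\<close>

lemma jointly_analytic_binop:
  fixes f g :: "real ^ 'k \<Rightarrow> real" and H :: "real \<Rightarrow> real \<Rightarrow> real" and G :: "complex \<Rightarrow> complex \<Rightarrow> complex"
  assumes f: "jointly_analytic f" and g: "jointly_analytic g"
    and H: "\<And>u v. G (of_real u) (of_real v) = of_real (H u v)"
    and cont: "\<And>(S::(complex \<times> (real ^ 'k)) set) p q.
      continuous_on S p \<Longrightarrow> continuous_on S q \<Longrightarrow> continuous_on S (\<lambda>x. G (p x) (q x))"
    and ana: "\<And>S p q. p analytic_on S \<Longrightarrow> q analytic_on S \<Longrightarrow> (\<lambda>z. G (p z) (q z)) analytic_on S"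
  shows "jointly_analytic (\<lambda>x. H (f x) (g x))"
  unfolding jointly_analytic_def
proof
  fix i
  obtain \<rho>1 P where P: "\<rho>1 > 1/2" "continuous_on (ellipse \<rho>1 \<times> unit_cube) (\<lambda>(z, x). P z x)"
    "\<And>x. x \<in> unit_cube \<Longrightarrow> (\<lambda>z. P z x) analytic_on ellipse \<rho>1 \<and>
       (\<forall>t\<in>{0..1}. P (of_real t) x = of_real (f (\<chi> j. if j = i then t else x $ j)))"
    using f unfolding jointly_analytic_def by meson
  obtain \<rho>2 Q where Q: "\<rho>2 > 1/2" "continuous_on (ellipse \<rho>2 \<times> unit_cube) (\<lambda>(z, x). Q z x)"
    "\<And>x. x \<in> unit_cube \<Longrightarrow> (\<lambda>z. Q z x) analytic_on ellipse \<rho>2 \<and>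
       (\<forall>t\<in>{0..1}. Q (of_real t) x = of_real (g (\<chi> j. if j = i then t else x $ j)))"
    using g unfolding jointly_analytic_def by meson
  define \<rho> where "\<rho> = min \<rho>1 \<rho>2"
  have \<rho>: "\<rho> > 1/2" using P(1) Q(1) by (simp add: \<rho>_def)
  have sub: "ellipse \<rho> \<subseteq> ellipse \<rho>1" "ellipse \<rho> \<subseteq> ellipse \<rho>2"
    using \<rho> by (intro ellipse_mono; simp add: \<rho>_def)+
  have "continuous_on (ellipse \<rho> \<times> unit_cube) (\<lambda>p. G (case p of (z, x) \<Rightarrow> P z x) (case p of (z, x) \<Rightarrow> Q z x))"
    using sub by (intro cont continuous_on_subset[OF P(2)] continuous_on_subset[OF Q(2)]) auto
  then have "continuous_on (ellipse \<rho> \<times> unit_cube) (\<lambda>(z, x). G (P z x) (Q z x))"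
    by (simp add: case_prod_unfold)
  moreover have "(\<lambda>z. G (P z x) (Q z x)) analytic_on ellipse \<rho>" if "x \<in> unit_cube" for x
    using P(3)[OF that] Q(3)[OF that] sub by (intro ana) (blast intro: analytic_on_subset)+
  ultimately show "\<exists>\<rho>>1/2. \<exists>F. continuous_on (ellipse \<rho> \<times> unit_cube) (\<lambda>(z, x). F z x) \<and>
        (\<forall>x\<in>unit_cube. (\<lambda>z. F z x) analytic_on ellipse \<rho> \<and>
          (\<forall>t\<in>{0..1}. F (of_real t) x =
             of_real (H (f (\<chi> j. if j = i then t else x $ j)) (g (\<chi> j. if j = i then t else x $ j)))))"
    using \<rho> P(3) Q(3) H
    by (intro exI[of _ \<rho>] conjI exI[of _ "\<lambda>z x. G (P z x) (Q z x)"]) auto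
qed

lemma jointly_analytic_add:
  "jointly_analytic f \<Longrightarrow> jointly_analytic g \<Longrightarrow> jointly_analytic (\<lambda>x. f x + g x)"
  by (rule jointly_analytic_binop[where G = "(+)"])
     (auto intro: continuous_on_add analytic_on_add)

lemma jointly_analytic_mult:
  "jointly_analytic f \<Longrightarrow> jointly_analytic g \<Longrightarrow> jointly_analytic (\<lambda>x. f x * g x)"
  by (rule jointly_analytic_binop[where G = "(*)"])
     (auto intro: continuous_on_mult analytic_on_mult)

lemma jointly_analytic_diff:
  "jointly_analytic f \<Longrightarrow> jointly_analytic g \<Longrightarrow> jointly_analytic (\<lambda>x. f x - g x)"
  by (rule jointly_analytic_binop[where G = "(-)"])
     (auto intro: continuous_on_diff analytic_on_diff)

lemma jointly_analytic_minus: "jointly_analytic f \<Longrightarrow> jointly_analytic (\<lambda>x. - f x)"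
  using jointly_analytic_diff[OF jointly_analytic_const[of 0]] by simp

lemma jointly_analytic_power: "jointly_analytic f \<Longrightarrow> jointly_analytic (\<lambda>x. f x ^ m)"
  by (induction m) (auto intro: jointly_analytic_const jointly_analytic_mult)

lemma jointly_analytic_sum:
  assumes "finite A" "\<And>a. a \<in> A \<Longrightarrow> jointly_analytic (f a)"
  shows "jointly_analytic (\<lambda>x. \<Sum>a\<in>A. f a x)"
  using assms
  by (induction rule: finite_induct) (auto intro: jointly_analytic_const jointly_analytic_add)

text \<open>The principal branch of the power is analytic off the nonpositive reals, so it suffices
  to keep the real part of the extension positive on a smaller ellipse that is the same for all
  \<open>x\<close>.\<close>

lemma jointly_analytic_powr:
  fixes f :: "real ^ 'k \<Rightarrow> real"
  assumes f: "jointly_analytic f" and pos: "\<And>x. x \<in> unit_cube \<Longrightarrow> f x > 0"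
  shows "jointly_analytic (\<lambda>x. f x powr r)"
  unfolding jointly_analytic_def
proof
  fix i
  obtain \<rho> F where F: "\<rho> > 1/2" "continuous_on (ellipse \<rho> \<times> unit_cube) (\<lambda>(z, x). F z x)"
    "\<And>x. x \<in> unit_cube \<Longrightarrow> (\<lambda>z. F z x) analytic_on ellipse \<rho>"
    "\<And>x t. x \<in> unit_cube \<Longrightarrow> t \<in> {0..1} \<Longrightarrow>
       F (of_real t) x = of_real (f (\<chi> j. if j = i then t else x $ j))"
    using f unfolding jointly_analytic_def by meson
  \<comment> \<open>The bad set is compact, hence so is its projection to the complex variable. That
    projection misses [0,1] because \<open>f\<close> is positive there, and an ellipse avoiding it
    works for every \<open>x\<close> at once.\<close>
  define B where "B = {p \<in> ellipse \<rho> \<times> unit_cube. Re (case p of (z, x) \<Rightarrow> F z x) \<le> 0}"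
  have comp: "compact (ellipse \<rho> \<times> (unit_cube :: (real ^ 'k) set))"
    by (intro compact_Times compact_ellipse) (simp add: unit_cube_eq_cbox)
  have "B = (ellipse \<rho> \<times> unit_cube) \<inter> (\<lambda>(z, x). F z x) -` {w. Re w \<le> 0}"
    by (auto simp: B_def)
  then have "closedin (top_of_set (ellipse \<rho> \<times> unit_cube)) B"
    using continuous_closedin_preimage[OF F(2) closed_halfspace_Re_le] by simp
  then have "compact B" using comp closedin_compact by blast
  then have "compact (fst ` B)" by (intro compact_continuous_image continuous_intros)
  moreover have "of_real t \<notin> fst ` B" if "t \<in> {0..1}" for t
  proof
    assume "of_real t \<in> fst ` B"
    then obtain x where "x \<in> unit_cube" "Re (F (of_real t) x) \<le> 0"
      by (auto simp: B_def)
    with F(4)[OF this(1) that] pos[OF unit_cube_update[OF this(1) that, of i]] show False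
      by simp
  qed
  ultimately obtain \<rho>' where \<rho>': "1/2 < \<rho>'" "\<rho>' \<le> \<rho>" "ellipse \<rho>' \<inter> fst ` B = {}"
    using ellipse_subset_complement[of "fst ` B" \<rho>] F(1) by blast
  have sub: "ellipse \<rho>' \<subseteq> ellipse \<rho>" using \<rho>' by (intro ellipse_mono)
  have RePos: "Re (F z x) > 0" if "z \<in> ellipse \<rho>'" "x \<in> unit_cube" for z x
  proof -
    have "(z, x) \<notin> B" using \<rho>'(3) that(1) by (metis disjoint_iff fst_conv image_eqI)
    then show ?thesis using that sub by (auto simp: B_def)
  qed
  have "continuous_on (ellipse \<rho>' \<times> unit_cube) (\<lambda>(z, x). F z x)"
    using sub by (intro continuous_on_subset[OF F(2)]) auto
  then have "continuous_on (ellipse \<rho>' \<times> unit_cube) (\<lambda>p. (\<lambda>(z, x). F z x) p powr of_real r)"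
    using RePos by (intro continuous_on_powr_complex continuous_on_const) (fastforce simp: complex_eq_iff)+
  then have "continuous_on (ellipse \<rho>' \<times> unit_cube) (\<lambda>(z, x). F z x powr of_real r)"
    by (simp only: case_prod_unfold)
  moreover have "(\<lambda>z. F z x powr of_real r) analytic_on ellipse \<rho>'" if "x \<in> unit_cube" for x
  proof (rule analytic_on_powr)
    show "(\<lambda>z. F z x) analytic_on ellipse \<rho>'"
      using F(3)[OF that] sub by (rule analytic_on_subset)
    show "F z x \<notin> \<real>\<^sub>\<le>\<^sub>0" if "z \<in> ellipse \<rho>'" for z
      using RePos[OF that \<open>x \<in> unit_cube\<close>] by (auto simp: complex_nonpos_Reals_iff)
  qed (rule analytic_on_const)
  moreover have "F (of_real t) x powr of_real r =
      of_real (f (\<chi> j. if j = i then t else x $ j) powr r)" if "x \<in> unit_cube" "t \<in> {0..1}" for x t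
    using F(4)[OF that] pos[OF unit_cube_update[OF that]] by (simp add: powr_of_real less_imp_le)
  ultimately show "\<exists>\<rho>>1/2. \<exists>F. continuous_on (ellipse \<rho> \<times> unit_cube) (\<lambda>(z, x). F z x) \<and>
        (\<forall>x\<in>unit_cube. (\<lambda>z. F z x) analytic_on ellipse \<rho> \<and>
          (\<forall>t\<in>{0..1}. F (of_real t) x =
             of_real (f (\<chi> j. if j = i then t else x $ j) powr r)))"
    using \<rho>'(1) by (intro exI[of _ \<rho>'] conjI exI[of _ "\<lambda>z x. F z x powr of_real r"]) auto
qed

lemmas jointly_analytic_intros =
  jointly_analytic_const jointly_analytic_coordinate jointly_analytic_add jointly_analytic_mult
  jointly_analytic_diff jointly_analytic_minus jointly_analytic_power


text \<open>The squared norm is a sum of squares of coordinates and so extends to complex arguments,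
  unlike the norm taken directly.\<close>

lemma jointly_analytic_inner_self:
  fixes w :: "real ^ 'k \<Rightarrow> 'v :: euclidean_space"
  assumes "\<And>u. jointly_analytic (\<lambda>\<eta>. w \<eta> \<bullet> u)"
  shows "jointly_analytic (\<lambda>\<eta>. w \<eta> \<bullet> w \<eta>)"
  by (subst euclidean_inner) (intro jointly_analytic_sum jointly_analytic_mult assms finite_Basis)

section \<open>Barycentric coordinates of the reference maps\<close>

lemma tet_map_eq:
  "tet_map a b c d x = a + x $ 1 *\<^sub>R (b - a) + x $ 2 *\<^sub>R (c - b) + x $ 3 *\<^sub>R (d - b)"
  by (simp add: tet_map_def tet_matrix_def vec_eq_iff matrix_vector_mult_def transpose_def sum_3 algebra_simps)

lemma panel_map_eq:
  "panel_map a b c y = a + y $ 1 *\<^sub>R (b - a) + y $ 2 *\<^sub>R (c - b)"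
  by (simp add: panel_map_def panel_matrix_def vec_eq_iff matrix_vector_mult_def transpose_def sum_2
      vector_2[where 'a = "real ^ 3"] algebra_simps)

text \<open>Coefficients are indexed by position in the list; distinctness makes the enumeration a
  bijection, through whose inverse they become coefficients of the vertices.\<close>

lemma affine_independent_list_coeffs:
  fixes vs :: "'v :: real_vector list"
  assumes "distinct vs" "\<not> affine_dependent (set vs)"
    and "(\<Sum>i<length vs. u i) = 0" "(\<Sum>i<length vs. u i *\<^sub>R vs ! i) = 0"
    and "i < length vs"
  shows "u i = 0"
proof (rule ccontr)
  assume "u i \<noteq> 0"
  define f where "f = inv_into {..<length vs} ((!) vs)"
  have bij: "bij_betw ((!) vs) {..<length vs} (set vs)"
    using assms(1) by (intro bij_betw_nth) auto
  then have f: "f (vs ! j) = j" if "j < length vs" for j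
    using that by (simp add: f_def bij_betw_inv_into_left)
  have "(\<Sum>v\<in>set vs. u (f v)) = 0"
    using assms(3) f by (simp add: sum.reindex_bij_betw[OF bij, symmetric])
  moreover have "(\<Sum>v\<in>set vs. u (f v) *\<^sub>R v) = 0"
    using assms(4) f by (simp add: sum.reindex_bij_betw[OF bij, symmetric])
  moreover have "vs ! i \<in> set vs" "u (f (vs ! i)) \<noteq> 0"
    using assms(5) \<open>u i \<noteq> 0\<close> f by auto
  ultimately have "affine_dependent (set vs)"
    by (subst affine_dependent_explicit_finite) (auto intro!: exI[of _ "\<lambda>v. u (f v)"])
  with assms(2) show False by contradiction
qed

lemma convex_hull_list_mem:
  fixes vs :: "'v :: real_vector list"
  assumes "(\<Sum>i<length vs. u i) = 1" "\<And>i. i < length vs \<Longrightarrow> 0 \<le> u i"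
  shows "(\<Sum>i<length vs. u i *\<^sub>R vs ! i) \<in> convex hull (set vs)"
  using assms by (intro convex_sum convex_convex_hull) (auto simp: hull_inc)

text \<open>Collecting terms by vertex gives the coefficients -p, p - q - r, q, r, whose sum is
  zero, so affine independence annihilates them.\<close>

lemma tet_coeffs_zero:
  fixes a b c d :: "'v :: real_vector"
  assumes "distinct [a, b, c, d]" "\<not> affine_dependent {a, b, c, d}"
    and "p *\<^sub>R (b - a) + q *\<^sub>R (c - b) + r *\<^sub>R (d - b) = 0"
  shows "p = 0 \<and> q = 0 \<and> r = 0"
proof -
  let ?u = "(!) [- p, p - q - r, q, r]"
  have "?u i = 0" if "i < 4" for i
    using affine_independent_list_coeffs[of "[a, b, c, d]" ?u i] assms that
    by (simp add: eval_nat_numeral lessThan_Suc algebra_simps)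
  from this[of 0] this[of 2] this[of 3] show ?thesis by simp
qed

lemma panel_coeffs_zero:
  fixes a b c :: "'v :: real_vector"
  assumes "distinct [a, b, c]" "\<not> affine_dependent {a, b, c}"
    and "p *\<^sub>R (b - a) + q *\<^sub>R (c - b) = 0"
  shows "p = 0 \<and> q = 0"
proof -
  let ?u = "(!) [- p, p - q, q]"
  have "?u i = 0" if "i < 3" for i
    using affine_independent_list_coeffs[of "[a, b, c]" ?u i] assms that
    by (simp add: eval_nat_numeral lessThan_Suc algebra_simps)
  from this[of 0] this[of 2] show ?thesis by simp
qed

text \<open>The barycentric coordinates are 1 - p, p - q - r, q, r; the hypotheses say that they are
  nonnegative.\<close>

lemma tet_point_mem:
  fixes a b c d :: "'v :: real_vector"
  assumes "p \<le> 1" "q + r \<le> p" "0 \<le> q" "0 \<le> r"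
  shows "a + p *\<^sub>R (b - a) + q *\<^sub>R (c - b) + r *\<^sub>R (d - b) \<in> convex hull {a, b, c, d}"
proof -
  let ?u = "(!) [1 - p, p - q - r, q, r]"
  have "0 \<le> ?u i" if "i < 4" for i
    using that assms by (auto simp: eval_nat_numeral less_Suc_eq)
  then show ?thesis
    using convex_hull_list_mem[where vs = "[a, b, c, d]" and u = ?u] assms
    by (simp add: eval_nat_numeral lessThan_Suc algebra_simps)
qed

lemma panel_point_mem:
  fixes a b c :: "'v :: real_vector"
  assumes "p \<le> 1" "q \<le> p" "0 \<le> q"
  shows "a + p *\<^sub>R (b - a) + q *\<^sub>R (c - b) \<in> convex hull {a, b, c}"
proof -
  let ?u = "(!) [1 - p, p - q, q]"
  have "0 \<le> ?u i" if "i < 3" for i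
    using that assms by (auto simp: eval_nat_numeral less_Suc_eq)
  then show ?thesis
    using convex_hull_list_mem[where vs = "[a, b, c]" and u = ?u] assms
    by (simp add: eval_nat_numeral lessThan_Suc algebra_simps)
qed

section \<open>Points where the two reference maps coincide\<close>

text \<open>An affinely independent set consists of exactly the extreme points of its hull, so a
  list of the vertices recovers the generating set.\<close>

lemma simplex_vertex_list:
  assumes "vertex_list S vs" "\<not> affine_dependent C" "S = convex hull C"
  shows "set vs = C" "distinct vs"
  using assms by (auto simp: vertex_list_def vertices_def extreme_point_of_convex_hull_affine_independent)

text \<open>
  A common point of the two cones spanned by \<open>t\<close> and \<open>\<tau>\<close> along the common edge can be scaled
  towards an interior point of that edge, where it lies in both \<open>t\<close> and \<open>\<tau>\<close>.
\<close>
lemma edge_maps_eq: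
  assumes t: "distinct [a, b, c, d]" "\<not> affine_dependent {a, b, c, d}"
    and \<tau>: "distinct [a, b, c']" "\<not> affine_dependent {a, b, c'}"
    and edge: "convex hull {a, b, c, d} \<inter> convex hull {a, b, c'} = closed_segment a b"
    and nonneg: "0 \<le> x $ 2" "0 \<le> x $ 3" "0 \<le> y $ 2"
    and eq: "panel_map a b c' y = tet_map a b c d x"
  shows "x $ 1 = y $ 1 \<and> x $ 2 = 0 \<and> x $ 3 = 0 \<and> y $ 2 = 0"
proof -
  \<comment> \<open>\<open>M\<close> bounds every coordinate combination below, so scaling by
    \<open>e\<close> makes each at most 1/2 in absolute value. \<open>P\<close> and \<open>Q\<close>
    are the images of the two points under this scaling, with \<open>a\<close> sent to the midpoint
    of the edge; the offset 1/2 then keeps their barycentric coordinates nonnegative.\<close>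
  define M where "M = 1 + \<bar>x $ 1\<bar> + x $ 2 + x $ 3 + \<bar>y $ 1\<bar> + y $ 2"
  define e where "e = 1 / (2 * M)"
  have M: "M > 0" using nonneg by (simp add: M_def add_pos_nonneg)
  then have e: "e > 0" by (simp add: e_def)
  have small: "\<bar>e * r\<bar> \<le> 1/2" if "\<bar>r\<bar> \<le> M" for r
    using that M by (simp add: e_def abs_mult field_simps)
  define P where "P = a + (1/2 + e * y $ 1) *\<^sub>R (b - a) + (e * y $ 2) *\<^sub>R (c' - b)"
  define Q where "Q = a + (1/2 + e * x $ 1) *\<^sub>R (b - a) + (e * x $ 2) *\<^sub>R (c - b) + (e * x $ 3) *\<^sub>R (d - b)"
  have "\<bar>e * y $ 1\<bar> \<le> 1/2" "\<bar>e * (y $ 1 - y $ 2)\<bar> \<le> 1/2"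
    using nonneg by (intro small; simp add: M_def)+
  then have "P \<in> convex hull {a, b, c'}"
    unfolding P_def using nonneg e by (intro panel_point_mem) (simp, unfold right_diff_distrib, linarith+, simp)
  moreover have "\<bar>e * x $ 1\<bar> \<le> 1/2" "\<bar>e * (x $ 1 - x $ 2 - x $ 3)\<bar> \<le> 1/2"
    using nonneg by (intro small; simp add: M_def)+
  then have "Q \<in> convex hull {a, b, c, d}"
    unfolding Q_def using nonneg e by (intro tet_point_mem) (simp, unfold right_diff_distrib, linarith+, simp_all)
  moreover have "P = Q"
  proof -
    have "e *\<^sub>R (panel_map a b c' y - a) = e *\<^sub>R (tet_map a b c d x - a)" using eq by simp
    then show ?thesis
      by (simp add: P_def Q_def tet_map_eq panel_map_eq algebra_simps)
  qed
  ultimately have "P \<in> closed_segment a b" using edge by blast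
  then obtain u where u: "P = (1 - u) *\<^sub>R a + u *\<^sub>R b" by (auto simp: in_segment)
  have "(1/2 + e * y $ 1 - u) *\<^sub>R (b - a) + (e * y $ 2) *\<^sub>R (c' - b) = 0"
    using u by (simp add: P_def algebra_simps)
  from panel_coeffs_zero[OF \<tau> this] have y: "1/2 + e * y $ 1 = u" "y $ 2 = 0" using e by auto
  have "(1/2 + e * x $ 1 - u) *\<^sub>R (b - a) + (e * x $ 2) *\<^sub>R (c - b) + (e * x $ 3) *\<^sub>R (d - b) = 0"
    using u \<open>P = Q\<close> by (simp add: Q_def algebra_simps)
  from tet_coeffs_zero[OF t this] have x: "1/2 + e * x $ 1 = u" "x $ 2 = 0" "x $ 3 = 0" using e by auto
  from x(1) y(1) have "e * x $ 1 = e * y $ 1" by linarith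
  then show ?thesis using x y e by simp
qed

text \<open>All panel vertices are vertices of \<open>t\<close>, so the equation is a linear
  relation among the independent edge vectors of \<open>t\<close>, and coordinates can be compared
  for arbitrary \<open>x\<close> and \<open>y\<close>.\<close>

lemma face_maps_eq:
  assumes "distinct [a, b, c, d]" "\<not> affine_dependent {a, b, c, d}"
    and "panel_map a b c y = tet_map a b c d x"
  shows "x $ 1 = y $ 1 \<and> x $ 2 = y $ 2 \<and> x $ 3 = 0"
proof -
  have "(x $ 1 - y $ 1) *\<^sub>R (b - a) + (x $ 2 - y $ 2) *\<^sub>R (c - b) + x $ 3 *\<^sub>R (d - b) = 0"
    using assms(3) by (simp add: tet_map_eq panel_map_eq algebra_simps)
  from tet_coeffs_zero[OF assms(1,2) this] show ?thesis by simp
qed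

text \<open>The inequalities place the two image points in the tetrahedron and in the panel, so if
  they coincide they equal \<open>a\<close>, whose reference coordinates vanish.\<close>

lemma vertex_maps_eq:
  assumes t: "distinct [a, b, c, d]" "\<not> affine_dependent {a, b, c, d}"
    and \<tau>: "distinct [a, b', c']" "\<not> affine_dependent {a, b', c'}"
    and vertex: "convex hull {a, b, c, d} \<inter> convex hull {a, b', c'} = {a}"
    and x: "x $ 1 \<le> 1" "x $ 2 + x $ 3 \<le> x $ 1" "0 \<le> x $ 2" "0 \<le> x $ 3"
    and y: "y $ 1 \<le> 1" "y $ 2 \<le> y $ 1" "0 \<le> y $ 2"
    and eq: "panel_map a b' c' y = tet_map a b c d x"
  shows "x $ 1 = 0 \<and> y $ 1 = 0"
proof -
  have "tet_map a b c d x \<in> convex hull {a, b, c, d}" "panel_map a b' c' y \<in> convex hull {a, b', c'}"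
    using x y by (simp_all add: tet_map_eq panel_map_eq tet_point_mem panel_point_mem)
  with vertex eq have "tet_map a b c d x = a" "panel_map a b' c' y = a" by auto
  then have "x $ 1 *\<^sub>R (b - a) + x $ 2 *\<^sub>R (c - b) + x $ 3 *\<^sub>R (d - b) = 0"
    "y $ 1 *\<^sub>R (b' - a) + y $ 2 *\<^sub>R (c' - b') = 0"
    by (simp_all add: tet_map_eq panel_map_eq add.assoc)
  with tet_coeffs_zero[OF t] panel_coeffs_zero[OF \<tau>] show ?thesis by blast
qed

section \<open>Affine extensions and the transformed kernel\<close>

text \<open>The points where two affine functions agree form an affine set, which contains the
  affine hull of \<open>S\<close>.\<close>

lemma affine_function_unique:
  assumes "affine_function l" "affine_function m" "\<And>x. x \<in> S \<Longrightarrow> l x = m x" "affine hull S = UNIV"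
  shows "l = m"
proof
  fix x
  obtain v c w e where l: "l = (\<lambda>x. v \<bullet> x + c)" and m: "m = (\<lambda>x. w \<bullet> x + e)"
    using assms(1,2) unfolding affine_function_def by blast
  have "S \<subseteq> {x. (v - w) \<bullet> x = e - c}"
    using assms(3) by (force simp: l m inner_diff_left)
  then have "affine hull S \<subseteq> {x. (v - w) \<bullet> x = e - c}"
    by (intro hull_minimal affine_hyperplane)
  then have "(v - w) \<bullet> x = e - c" using assms(4) by auto
  then show "l x = m x" by (simp add: l m inner_diff_left)
qed

text \<open>Justifies the definite description in \<open>affine_ext\<close>: \<open>u\<close> being
  affine on \<open>t\<close> gives existence, full dimension of \<open>t\<close> gives
  uniqueness.\<close>

lemma affine_function_affine_ext:
  assumes "affine_function l" "\<And>x. x \<in> t \<Longrightarrow> u x = l x" "affine hull t = UNIV"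
  shows "affine_function (affine_ext t u)"
proof -
  have "\<exists>!l. affine_function l \<and> (\<forall>x\<in>t. l x = u x)"
    using assms affine_function_unique[OF _ _ _ assms(3)] by (metis (no_types, lifting))
  from theI'[OF this] show ?thesis by (simp add: affine_ext_def)
qed

text \<open>The only factor not built from sums and products is the denominator. It becomes the
  power -(3 + 2s)/2 of \<open>w \<eta> \<bullet> w \<eta>\<close>, whose base is jointly analytic
  and, by \<open>ne\<close>, positive on the cube.\<close>

lemma jointly_analytic_k2:
  fixes x :: "real ^ 'k \<Rightarrow> real ^ 3" and y :: "real ^ 'k \<Rightarrow> real ^ 2"
  assumes l: "affine_function l1" "affine_function l2"
    and x: "jointly_analytic (\<lambda>\<eta>. x \<eta> $ 1)" "jointly_analytic (\<lambda>\<eta>. x \<eta> $ 2)" "jointly_analytic (\<lambda>\<eta>. x \<eta> $ 3)"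
    and y: "jointly_analytic (\<lambda>\<eta>. y \<eta> $ 1)" "jointly_analytic (\<lambda>\<eta>. y \<eta> $ 2)"
    and ne: "\<And>\<eta>. \<eta> \<in> unit_cube \<Longrightarrow> panel_map a' b' c' (y \<eta>) \<noteq> tet_map a b c d (x \<eta>)"
  shows "jointly_analytic (\<lambda>\<eta>. k2 s l1 l2 a b c d a' b' c' n (x \<eta>) (y \<eta>))"
proof -
  define X where "X = (\<lambda>\<eta>. tet_map a b c d (x \<eta>))"
  define w where "w = (\<lambda>\<eta>. panel_map a' b' c' (y \<eta>) - X \<eta>)"
  have X: "jointly_analytic (\<lambda>\<eta>. X \<eta> \<bullet> u)" for u
    unfolding X_def tet_map_eq inner_add_left inner_scaleR_left by (intro jointly_analytic_intros x)
  have w: "jointly_analytic (\<lambda>\<eta>. w \<eta> \<bullet> u)" for u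
    unfolding w_def panel_map_eq inner_add_left inner_diff_left inner_scaleR_left
    by (intro jointly_analytic_intros y X)
  have lX: "jointly_analytic (\<lambda>\<eta>. l (X \<eta>))" if "affine_function l" for l
    using that X unfolding affine_function_def
    by (auto simp: inner_commute intro!: jointly_analytic_add jointly_analytic_const)
  have "w \<eta> \<bullet> w \<eta> > 0" if "\<eta> \<in> unit_cube" for \<eta>
    using ne[OF that] by (simp add: w_def X_def)
  then have "jointly_analytic (\<lambda>\<eta>. (w \<eta> \<bullet> w \<eta>) powr (- (3 + 2 * s) / 2))"
    by (intro jointly_analytic_powr jointly_analytic_inner_self w)
  then have "jointly_analytic (\<lambda>\<eta>. l1 (X \<eta>) * l2 (X \<eta>) *
      ((w \<eta> \<bullet> n) * (w \<eta> \<bullet> w \<eta>) powr (- (3 + 2 * s) / 2)) *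
      \<bar>det (tet_matrix a b c d)\<bar> * norm (cross3 (b' - a') (c' - b')))"
    by (intro jointly_analytic_intros lX l w)
  then show ?thesis
  proof (rule jointly_analytic_cong)
    fix \<eta> :: "real ^ 'k" assume "\<eta> \<in> unit_cube"
    then have "w \<eta> \<noteq> 0" using ne by (simp add: w_def X_def)
    have exponent: "2 * (- (3 + 2 * s) / 2) = - (3 + 2 * s)" by simp
    from \<open>w \<eta> \<noteq> 0\<close> have "(w \<eta> \<bullet> w \<eta>) powr (- (3 + 2 * s) / 2) = (norm (w \<eta>) powr 2) powr (- (3 + 2 * s) / 2)"
      by (simp add: dot_square_norm powr_numeral)
    also have "\<dots> = 1 / norm (w \<eta>) powr (3 + 2 * s)"
      by (simp only: powr_powr powr_minus_divide[symmetric] exponent)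
    finally show "l1 (X \<eta>) * l2 (X \<eta>) *
      ((w \<eta> \<bullet> n) * (w \<eta> \<bullet> w \<eta>) powr (- (3 + 2 * s) / 2)) *
      \<bar>det (tet_matrix a b c d)\<bar> * norm (cross3 (b' - a') (c' - b')) =
      k2 s l1 l2 a b c d a' b' c' n (x \<eta>) (y \<eta>)"
      by (simp add: k2_def w_def X_def)
  qed
qed

section \<open>Nonvanishing for the three regularizing rules\<close>

text \<open>Meant for the face rule, where some third coordinates are 1 - e1 * e2.\<close>

lemma unit_interval_mult_eq_1:
  fixes u v :: real
  assumes "u \<le> 1" "v \<le> 1" "0 \<le> u" "0 \<le> v"
  shows "u * v = 1 \<longleftrightarrow> u = 1 \<and> v = 1"
proof
  assume "u * v = 1"
  moreover have "u * v \<le> u" "u * v \<le> v"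
    using assms by (auto intro: mult_left_le mult_left_le_one_le)
  ultimately show "u = 1 \<and> v = 1" using assms by linarith
qed simp

text \<open>Coincidence would force equal first and equal second coordinates and a vanishing third
  one; each of the nine entries violates this throughout the cube.\<close>

lemma well_defined_rule_F:
  assumes "distinct [a, b, c, d]" "\<not> affine_dependent {a, b, c, d}"
  shows "well_defined_on_cube rule_F (tet_map a b c d) (panel_map a b c)"
  unfolding well_defined_on_cube_def
proof (intro ballI, clarify)
  fix \<eta> :: "real ^ 2" and x y J
  assume \<eta>: "\<eta> \<in> unit_cube" and mem: "(x, y, J) \<in> set (rule_F \<eta>)"
    and eq: "panel_map a b c y = tet_map a b c d x"
  define e1 e2 where "e1 = \<eta> $ 1" "e2 = \<eta> $ 2"
  have e: "0 \<le> e1" "e1 \<le> 1" "0 \<le> e2" "e2 \<le> 1"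
    using \<eta> by (auto simp: unit_cube_def e1_e2_def)
  show False
    using mem face_maps_eq[OF assms eq] e unit_interval_mult_eq_1[of e1 e2]
    unfolding rule_F_def Let_def e1_e2_def[symmetric] by auto
qed

text \<open>First coordinates may be negative here, so the image points can lie outside
  \<open>t\<close> or the panel; the remaining coordinates are nonnegative, which is what
  \<open>edge_maps_eq\<close> asks for. No entry satisfies its conclusion.\<close>

lemma well_defined_rule_E:
  assumes "distinct [a, b, c, d]" "\<not> affine_dependent {a, b, c, d}"
    and "distinct [a, b, c']" "\<not> affine_dependent {a, b, c'}"
    and "convex hull {a, b, c, d} \<inter> convex hull {a, b, c'} = closed_segment a b"
  shows "well_defined_on_cube rule_E (tet_map a b c d) (panel_map a b c')"
  unfolding well_defined_on_cube_def
proof (intro ballI, clarify)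
  fix \<eta> :: "real ^ 3" and x y J
  assume \<eta>: "\<eta> \<in> unit_cube" and mem: "(x, y, J) \<in> set (rule_E \<eta>)"
    and eq: "panel_map a b c' y = tet_map a b c d x"
  define e1 e2 e3 where "e1 = \<eta> $ 1" "e2 = \<eta> $ 2" "e3 = \<eta> $ 3"
  have e: "0 \<le> e1" "e1 \<le> 1" "0 \<le> e2" "e2 \<le> 1" "0 \<le> e3" "e3 \<le> 1"
    using \<eta> by (auto simp: unit_cube_def e1_e2_e3_def)
  have "0 \<le> x $ 2" "0 \<le> x $ 3" "0 \<le> y $ 2"
    using mem e unfolding rule_E_def Let_def e1_e2_e3_def[symmetric] by auto
  from edge_maps_eq[OF assms this eq] show False
    using mem e unfolding rule_E_def Let_def e1_e2_e3_def[symmetric] by auto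
qed

text \<open>Both reference points stay in the reference simplices and one of them has first
  coordinate 1, whereas coincidence would make both first coordinates 0.\<close>

lemma well_defined_rule_V:
  assumes "distinct [a, b, c, d]" "\<not> affine_dependent {a, b, c, d}"
    and "distinct [a, b', c']" "\<not> affine_dependent {a, b', c'}"
    and "convex hull {a, b, c, d} \<inter> convex hull {a, b', c'} = {a}"
  shows "well_defined_on_cube rule_V (tet_map a b c d) (panel_map a b' c')"
  unfolding well_defined_on_cube_def
proof (intro ballI, clarify)
  fix \<eta> :: "real ^ 4" and x y J
  assume \<eta>: "\<eta> \<in> unit_cube" and mem: "(x, y, J) \<in> set (rule_V \<eta>)"
    and eq: "panel_map a b' c' y = tet_map a b c d x"
  define e1 e2 e3 e4 where "e1 = \<eta> $ 1" "e2 = \<eta> $ 2" "e3 = \<eta> $ 3" "e4 = \<eta> $ 4"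
  have e: "0 \<le> e1" "e1 \<le> 1" "0 \<le> e2" "e2 \<le> 1" "0 \<le> e3" "e3 \<le> 1" "0 \<le> e4" "e4 \<le> 1"
    using \<eta> by (auto simp: unit_cube_def e1_e2_e3_e4_def)
  consider "x = vector [1, e1 * e2, e1 * (1 - e2)]" "y = vector [e3, e3 * e4]"
    | "x = vector [e2, e2 * e3 * e4, e2 * e3 * (1 - e4)]" "y = vector [1, e1]"
    using mem unfolding rule_V_def Let_def e1_e2_e3_e4_def[symmetric] by auto
  then have "x $ 1 \<le> 1" "x $ 2 + x $ 3 \<le> x $ 1" "0 \<le> x $ 2" "0 \<le> x $ 3"
    "y $ 1 \<le> 1" "y $ 2 \<le> y $ 1" "0 \<le> y $ 2" "x $ 1 = 1 \<or> y $ 1 = 1"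
    using e by (cases; simp add: distrib_left[symmetric] mult_left_le)+
  with vertex_maps_eq[OF assms _ _ _ _ _ _ _ eq] show False by auto
qed

text \<open>The coordinates and weights of every entry are polynomials in \<open>\<eta>\<close>, and
  well-definedness supplies the nonvanishing that \<open>jointly_analytic_k2\<close>
  requires.\<close>

lemma regularized_rule_analytic:
  assumes "affine_function l1" "affine_function l2"
  shows "well_defined_on_cube rule_F (tet_map a b c d) (panel_map a' b' c') \<Longrightarrow>
      jointly_analytic (regularized rule_F (k2 s l1 l2 a b c d a' b' c' n))"
    and "well_defined_on_cube rule_E (tet_map a b c d) (panel_map a' b' c') \<Longrightarrow>
      jointly_analytic (regularized rule_E (k2 s l1 l2 a b c d a' b' c' n))"
    and "well_defined_on_cube rule_V (tet_map a b c d) (panel_map a' b' c') \<Longrightarrow>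
      jointly_analytic (regularized rule_V (k2 s l1 l2 a b c d a' b' c' n))"
  unfolding regularized_def[abs_def] well_defined_on_cube_def rule_F_def rule_E_def rule_V_def Let_def
  by (simp, intro jointly_analytic_intros jointly_analytic_k2 assms;
      simp; intro jointly_analytic_intros)+

theorem lemma4p9:
  fixes \<Omega> :: "(real ^ 3) set" and \<T> :: "(real ^ 3) set set"
    and \<theta> c\<^sub>1 c\<^sub>2 c\<^sub>A s :: real
    and \<phi> :: "nat \<Rightarrow> real ^ 3 \<Rightarrow> real" and N i j :: nat
    and t \<tau> :: "(real ^ 3) set"
    and a b c d a' b' c' n :: "real ^ 3"
    and k :: "real ^ 3 \<Rightarrow> real ^ 2 \<Rightarrow> real"
  assumes "mesh \<Omega> \<T> \<theta> c\<^sub>1 c\<^sub>2 c\<^sub>A"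
    and "nodal_basis \<Omega> \<T> N \<phi>" and "i \<in> {1..N}" and "j \<in> {1..N}"
    and "0 < s" and "s < 1"
    and "t \<in> \<T>" and "\<tau> \<in> panels \<T>"
    and "vertex_list t [a, b, c, d]" and "vertex_list \<tau> [a', b', c']"
    and "unit_normal \<tau> n"
    and "k = k2 s (affine_ext t (\<phi> i)) (affine_ext t (\<phi> j)) a b c d a' b' c' n"
  shows
    "(\<tau> facet_of t \<and> a = a' \<and> b = b' \<and> c = c' \<longrightarrow>
       well_defined_on_cube rule_F (tet_map a b c d) (panel_map a' b' c') \<and>
       componentwise_analytic (\<lambda>\<eta>. complex_of_real (regularized rule_F k \<eta>))) \<and>
     (t \<inter> \<tau> = closed_segment a b \<and> a = a' \<and> b = b' \<longrightarrow>
       well_defined_on_cube rule_E (tet_map a b c d) (panel_map a' b' c') \<and>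
       componentwise_analytic (\<lambda>\<eta>. complex_of_real (regularized rule_E k \<eta>))) \<and>
     (t \<inter> \<tau> = {a} \<and> a = a' \<longrightarrow>
       well_defined_on_cube rule_V (tet_map a b c d) (panel_map a' b' c') \<and>
       componentwise_analytic (\<lambda>\<eta>. complex_of_real (regularized rule_V k \<eta>)))"
proof -
  interpret mesh \<Omega> \<T> \<theta> c\<^sub>1 c\<^sub>2 c\<^sub>A by fact
  obtain C where C: "\<not> affine_dependent C" "int (card C) = 3 + 1" "t = convex hull C"
    using tetrahedra[OF \<open>t \<in> \<T>\<close>] unfolding simplex_def by blast
  with simplex_vertex_list[OF assms(9) C(1,3)]
  have t: "distinct [a, b, c, d]" "\<not> affine_dependent {a, b, c, d}" "t = convex hull {a, b, c, d}"
    by auto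
  \<comment> \<open>The panel is a facet of some element \<open>t'\<close>, which may differ from
    \<open>t\<close>; the affine independence of its vertices is inherited from
    \<open>t'\<close>.\<close>
  obtain t' where "t' \<in> \<T>" "\<tau> facet_of t'" using assms(8) by (auto simp: panels_def)
  moreover obtain D where D: "\<not> affine_dependent D" "t' = convex hull D"
    using tetrahedra[OF \<open>t' \<in> \<T>\<close>] unfolding simplex_def by blast
  ultimately obtain v where v: "\<tau> = convex hull (D - {v})"
    using facet_of_convex_hull_affine_independent[OF D(1)] by blast
  have "\<not> affine_dependent (D - {v})"
    using D(1) affine_independent_Diff by blast
  with simplex_vertex_list[OF assms(10) this v] v
  have \<tau>: "distinct [a', b', c']" "\<not> affine_dependent {a', b', c'}" "\<tau> = convex hull {a', b', c'}"
    by auto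
  \<comment> \<open>Full dimension makes the affine function coinciding with a nodal basis function
    on \<open>t\<close> unique.\<close>
  have "aff_dim t = 3" using tetrahedra[OF \<open>t \<in> \<T>\<close>] by (simp add: aff_dim_simplex)
  then have "affine hull t = UNIV" using aff_dim_eq_full[of t] by simp
  moreover have "\<exists>l. affine_function l \<and> (\<forall>x\<in>t. \<phi> m x = l x)" if "m \<in> {1..N}" for m
    using assms(2,7) that unfolding nodal_basis_def p1_space_def by blast
  ultimately have "affine_function (affine_ext t (\<phi> m))" if "m \<in> {1..N}" for m
    using affine_function_affine_ext that by metis
  note analytic = regularized_rule_analytic[OF this[OF assms(3)] this[OF assms(4)],
      THEN jointly_analytic_imp_componentwise_analytic]
  show ?thesis
    unfolding assms(12)
  proof (intro conjI impI; elim conjE)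
    assume "a = a'" "b = b'" "c = c'"
    then show "well_defined_on_cube rule_F (tet_map a b c d) (panel_map a' b' c')"
      using well_defined_rule_F[OF t(1,2)] by simp
    then show "componentwise_analytic (\<lambda>\<eta>. complex_of_real (regularized rule_F
        (k2 s (affine_ext t (\<phi> i)) (affine_ext t (\<phi> j)) a b c d a' b' c' n) \<eta>))"
      by (rule analytic)
  next
    assume "t \<inter> \<tau> = closed_segment a b" "a = a'" "b = b'"
    then show "well_defined_on_cube rule_E (tet_map a b c d) (panel_map a' b' c')"
      using well_defined_rule_E[OF t(1,2), of c'] t(3) \<tau> by simp
    then show "componentwise_analytic (\<lambda>\<eta>. complex_of_real (regularized rule_E
        (k2 s (affine_ext t (\<phi> i)) (affine_ext t (\<phi> j)) a b c d a' b' c' n) \<eta>))"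
      by (rule analytic)
  next
    assume "t \<inter> \<tau> = {a}" "a = a'"
    then show "well_defined_on_cube rule_V (tet_map a b c d) (panel_map a' b' c')"
      using well_defined_rule_V[OF t(1,2), of b' c'] t(3) \<tau> by simp
    then show "componentwise_analytic (\<lambda>\<eta>. complex_of_real (regularized rule_V
        (k2 s (affine_ext t (\<phi> i)) (affine_ext t (\<phi> j)) a b c d a' b' c' n) \<eta>))"
      by (rule analytic)
  qed
qed

end
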